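(* Let $P=(X,\prec)$ be a finite poset, let $t\in\mathbb N$, and let $z\in X$. Then, for every integer $0\le k\le t$, $$\Omega_{\mathbf q}(P,t;z,k)^2\ \geqslant_{\mathbf q}\ \Omega_{\mathbf q}(P,t;z,k-1)\cdot\Omega_{\mathbf q}(P,t;z,k+1).$$ More generally, for all integers $a,b\ge 1$ (and every integer $0\le k\le t$), $$\Omega_{\mathbf q}(P,t;z,k+a)\cdot\Omega_{\mathbf q}(P,t;z,k+b)\ \geqslant_{\mathbf q}\ \Omega_{\mathbf q}(P,t;z,k)\cdot\Omega_{\mathbf q}(P,t;z,k+a+b).$$
   Context: $\mathbb N=\{0,1,2,\dots\}$. Write $X=\{x_1,\dots,x_n\}$, labeled so that $x_i\mapsto i$ is a linear extension of $P$ (natural labeling), and let $\mathbf q=(q_1,\dots,q_n)$ be variables. $\mathrm{PP}(P,t)$ is the set of maps $T:X\to\{0,1,\dots,t\}$ with $T(x)\le T(y)$ whenever $x\prec y$. For an integer $k$, $$\Omega_{\mathbf q}(P,t;z,k):=\sum_{T\in\mathrm{PP}(P,t),\ T(z)=k}q_1^{T(x_1)}\cdots q_n^{T(x_n)},$$ which is $0$ if $k<0$ or $k>t$. For $F,G\in\mathbb R[q_1,\dots,q_n]$, $F\geqslant_{\mathbf q}G$ means that all coefficients of $F-G$ are nonnegative. *)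

theory Defs
  imports Complex_Main "HOL-Library.FuncSet" "HOL-Library.Poly_Mapping"
begin

text \<open>A finite poset is given by a carrier and its strict order relation; only the restriction
  of the relation to the carrier matters.\<close>

definition finite_poset :: "'a set \<Rightarrow> ('a \<Rightarrow> 'a \<Rightarrow> bool) \<Rightarrow> bool" where
  "finite_poset X prec \<longleftrightarrow> finite X \<and> irreflp_on X prec \<and> transp_on X prec"

definition natural_labeling :: "'a set \<Rightarrow> ('a \<Rightarrow> 'a \<Rightarrow> bool) \<Rightarrow> nat \<Rightarrow> (nat \<Rightarrow> 'a) \<Rightarrow> bool" where
  "natural_labeling X prec n x \<longleftrightarrow>
     bij_betw x {1..n} X \<and> (\<forall>i\<in>{1..n}. \<forall>j\<in>{1..n}. prec (x i) (x j) \<longrightarrow> i < j)"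

text \<open>Extensional maps are used so that each map on \<open>X\<close> is represented exactly once.\<close>

definition PP :: "'a set \<Rightarrow> ('a \<Rightarrow> 'a \<Rightarrow> bool) \<Rightarrow> nat \<Rightarrow> ('a \<Rightarrow> nat) set" where
  "PP X prec t = {T \<in> X \<rightarrow>\<^sub>E {0..t}. \<forall>x\<in>X. \<forall>y\<in>X. prec x y \<longrightarrow> T x \<le> T y}"

text \<open>Real polynomials in variables indexed by the natural numbers: finitely supported maps from
  exponent vectors to coefficients, with the convolution product of \<open>Poly_Mapping\<close>. The ring
  \<open>\<real>[q\<^sub>1, \<dots>, q\<^sub>n]\<close> is the subring involving only the variables with index in \<open>{1..n}\<close>.\<close>

type_synonym real_mpoly = "(nat \<Rightarrow>\<^sub>0 nat) \<Rightarrow>\<^sub>0 real"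

definition qvar :: "nat \<Rightarrow> real_mpoly" where
  "qvar i = Poly_Mapping.single (Poly_Mapping.single i 1) 1"

definition Omega_q ::
  "'a set \<Rightarrow> ('a \<Rightarrow> 'a \<Rightarrow> bool) \<Rightarrow> nat \<Rightarrow> (nat \<Rightarrow> 'a) \<Rightarrow> nat \<Rightarrow> 'a \<Rightarrow> int \<Rightarrow> real_mpoly" where
  "Omega_q X prec n x t z k =
     (\<Sum>T\<in>{T \<in> PP X prec t. int (T z) = k}. \<Prod>i=1..n. qvar i ^ T (x i))"

definition coeff_ge :: "real_mpoly \<Rightarrow> real_mpoly \<Rightarrow> bool" (infix "\<ge>\<^sub>q" 50) where
  "F \<ge>\<^sub>q G \<longleftrightarrow> (\<forall>m. 0 \<le> Poly_Mapping.lookup (F - G) m)"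

end

theory Submission
  imports Defs
begin

text \<open>
  The coefficient of \<open>q\<^sup>m\<close> in a product of two of the polynomials counts pairs \<open>(T, S)\<close> of
  \<open>P\<close>-partitions with prescribed values at \<open>z\<close> and prescribed pointwise sum
  \<open>T + S = \<mu>\<close>, where \<open>\<mu>\<close> is read off from \<open>m\<close>. Such a pair is determined by \<open>T\<close>, so the
  claim says that the number \<open>A\<^sub>k\<close> of admissible \<open>T\<close> with \<open>T z = k\<close> satisfies
  \<open>A\<^sub>k \<le> A\<^bsub>k+a\<^esub>\<close> whenever \<open>\<mu> z = 2k + a + b\<close>.

  The admissible \<open>T\<close> are closed under pointwise maximum and minimum: if \<open>T\<close> and
  \<open>\<mu> - T\<close> are both order preserving, and the same holds for \<open>E\<close>, then it holds for
  \<open>max T E\<close> and \<open>min T E\<close>. Let \<open>B\<^sub>j\<close> count the integer-valued maps with value \<open>j\<close> at \<open>z\<close> that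
  satisfy the same order conditions but whose range condition is relaxed by \<open>b\<close> downwards.
  If \<open>T\<close> is counted by \<open>A\<^sub>k\<close> and \<open>E\<close> by \<open>B\<^bsub>k+a\<^esub>\<close>, then \<open>max T E\<close> is counted by
  \<open>A\<^bsub>k+a\<^esub>\<close> (the lower bounds come from \<open>T\<close>) and \<open>min T E\<close> by \<open>B\<^sub>k\<close>. The four functions
  theorem of Ahlswede and Daykin (\<open>four_functions\<close>, used in the form
  \<open>card_functions_max_min\<close>) turns this into \<open>A\<^sub>k B\<^bsub>k+a\<^esub> \<le> A\<^bsub>k+a\<^esub> B\<^sub>k\<close>.

  The relaxation is chosen so that the reflection \<open>T \<mapsto> \<mu> - b - T\<close> is a symmetry of the relaxed
  conditions. It exchanges the values \<open>k\<close> and \<open>k + a\<close> at \<open>z\<close>, so \<open>B\<^sub>k = B\<^bsub>k+a\<^esub>\<close>. This common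
  number is at least \<open>A\<^sub>k\<close>, because the exact conditions imply the relaxed ones; so if
  \<open>A\<^sub>k > 0\<close> it can be cancelled (\<open>card_splittings_le\<close>).
\<close>

section \<open>The four functions theorem\<close>

text \<open>The case of a one-element ground set, which is also the induction step of the general
  theorem. Only the mixed products need an argument: both \<open>p = a0 b1\<close> and \<open>q = a1 b0\<close> are
  at most \<open>r = c1 d0\<close>, and their product is at most \<open>r s\<close> with \<open>s = c0 d1\<close>; since
  \<open>(r - p)(r - q) \<ge> 0\<close>, this forces \<open>p + q \<le> r + s\<close>.\<close>

lemma four_functions_two_point:
  fixes a0 a1 b0 b1 c0 c1 d0 d1 :: real
  assumes nonneg: "0 \<le> a0" "0 \<le> a1" "0 \<le> b0" "0 \<le> b1" "0 \<le> c0" "0 \<le> c1" "0 \<le> d0" "0 \<le> d1"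
    and h00: "a0 * b0 \<le> c0 * d0" and h01: "a0 * b1 \<le> c1 * d0"
    and h10: "a1 * b0 \<le> c1 * d0" and h11: "a1 * b1 \<le> c1 * d1"
  shows "(a0 + a1) * (b0 + b1) \<le> (c0 + c1) * (d0 + d1)"
proof -
  define p q r s where "p = a0 * b1" and "q = a1 * b0" and "r = c1 * d0" and "s = c0 * d1"
  have pq: "0 \<le> p" "0 \<le> q" "p \<le> r" "q \<le> r" "0 \<le> s"
    using nonneg h01 h10 by (simp_all add: p_def q_def r_def s_def)
  have "p + q \<le> r + s"
  proof (cases "r = 0")
    case True
    then show ?thesis using pq by linarith
  next
    case False
    then have "0 < r" using pq by linarith
    have "p * q = (a0 * b0) * (a1 * b1)" by (simp add: p_def q_def)
    also have "\<dots> \<le> (c0 * d0) * (c1 * d1)"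
      by (rule mult_mono[OF h00 h11]) (use nonneg in simp_all)
    also have "\<dots> = r * s" by (simp add: r_def s_def)
    finally have "p * q \<le> r * s" .
    moreover have "0 \<le> (r - p) * (r - q)" using pq by simp
    ultimately have "r * (p + q) \<le> r * (r + s)" by (simp add: algebra_simps)
    then show ?thesis using \<open>0 < r\<close> by simp
  qed
  then show ?thesis
    using h00 h11 by (simp add: p_def q_def r_def s_def algebra_simps)
qed

lemma sum_Pow_insert:
  fixes f :: "'a set \<Rightarrow> 'b::comm_monoid_add"
  assumes "finite S" "e \<notin> S"
  shows "sum f (Pow (insert e S)) = (\<Sum>A\<in>Pow S. f A + f (insert e A))"
proof -
  have "inj_on (insert e) (Pow S)"
    using assms(2) by (auto simp: inj_on_def)
  moreover have "Pow S \<inter> insert e ` Pow S = {}"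
    using assms(2) by auto
  ultimately show ?thesis
    using assms(1)
    by (simp add: Pow_insert sum.union_disjoint sum.reindex sum.distrib)
qed

text \<open>Induction on the ground set: pushing each function forward along \<open>A \<mapsto> A - {e}\<close> preserves
  the hypothesis by the two-point case, and preserves the total sums.\<close>

theorem four_functions:
  fixes \<alpha> \<beta> \<gamma> \<delta> :: "'a set \<Rightarrow> real"
  assumes "finite S"
    and "\<And>A. 0 \<le> \<alpha> A" "\<And>A. 0 \<le> \<beta> A" "\<And>A. 0 \<le> \<gamma> A" "\<And>A. 0 \<le> \<delta> A"
    and "\<And>A B. A \<subseteq> S \<Longrightarrow> B \<subseteq> S \<Longrightarrow> \<alpha> A * \<beta> B \<le> \<gamma> (A \<union> B) * \<delta> (A \<inter> B)"
  shows "sum \<alpha> (Pow S) * sum \<beta> (Pow S) \<le> sum \<gamma> (Pow S) * sum \<delta> (Pow S)"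
  using assms
proof (induction S arbitrary: \<alpha> \<beta> \<gamma> \<delta> rule: finite_induct)
  case empty
  then show ?case by simp
next
  case (insert e S)
  let ?push = "\<lambda>f A. f A + f (insert e A) :: real"
  note sub = insert.prems(5)
  have "?push \<alpha> A * ?push \<beta> B \<le> ?push \<gamma> (A \<union> B) * ?push \<delta> (A \<inter> B)"
    if "A \<subseteq> S" "B \<subseteq> S" for A B
  proof -
    have e: "e \<notin> A" "e \<notin> B" using that insert.hyps by auto
    have i: "A \<inter> insert e B = A \<inter> B" "insert e A \<inter> B = A \<inter> B" using e by auto
    show ?thesis
      using that sub[of A B] sub[of A "insert e B"] sub[of "insert e A" B]
        sub[of "insert e A" "insert e B"] insert.prems(1-4)
      by (intro four_functions_two_point) (auto simp: i)
  qed
  then have "sum (?push \<alpha>) (Pow S) * sum (?push \<beta>) (Pow S)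
      \<le> sum (?push \<gamma>) (Pow S) * sum (?push \<delta>) (Pow S)"
    using insert.prems(1-4) by (intro insert.IH) (auto intro: add_nonneg_nonneg)
  then show ?case
    using insert.hyps by (simp add: sum_Pow_insert)
qed

lemma card_families_union_inter:
  fixes \<F> \<G> \<H> \<K> :: "'a set set"
  assumes "finite S" and sub: "\<F> \<subseteq> Pow S" "\<G> \<subseteq> Pow S" "\<H> \<subseteq> Pow S" "\<K> \<subseteq> Pow S"
    and un: "\<And>A B. A \<in> \<F> \<Longrightarrow> B \<in> \<G> \<Longrightarrow> A \<union> B \<in> \<H>"
    and int: "\<And>A B. A \<in> \<F> \<Longrightarrow> B \<in> \<G> \<Longrightarrow> A \<inter> B \<in> \<K>"
  shows "card \<F> * card \<G> \<le> card \<H> * card \<K>"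
proof -
  have card: "(\<Sum>A\<in>Pow S. of_bool (A \<in> \<C>)) = real (card \<C>)" if "\<C> \<subseteq> Pow S" for \<C>
    using that \<open>finite S\<close> by (simp add: Int_absorb1)
  have "real (card \<F>) * real (card \<G>) \<le> real (card \<H>) * real (card \<K>)"
    unfolding card[OF sub(1), symmetric] card[OF sub(2), symmetric]
      card[OF sub(3), symmetric] card[OF sub(4), symmetric]
    using \<open>finite S\<close> un int by (intro four_functions) auto
  then show ?thesis
    by (simp flip: of_nat_mult)
qed

text \<open>A function into a chain is encoded by the set of points below its graph. Under this encoding
  pointwise maximum and minimum become union and intersection.\<close>

lemma card_functions_max_min:
  fixes F G H K :: "('a \<Rightarrow> 'b::linorder) set"
  assumes "finite X" "finite V"
    and sub: "F \<subseteq> X \<rightarrow>\<^sub>E V" "G \<subseteq> X \<rightarrow>\<^sub>E V" "H \<subseteq> X \<rightarrow>\<^sub>E V" "K \<subseteq> X \<rightarrow>\<^sub>E V"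
    and max: "\<And>f g. f \<in> F \<Longrightarrow> g \<in> G \<Longrightarrow> (\<lambda>x\<in>X. max (f x) (g x)) \<in> H"
    and min: "\<And>f g. f \<in> F \<Longrightarrow> g \<in> G \<Longrightarrow> (\<lambda>x\<in>X. min (f x) (g x)) \<in> K"
  shows "card F * card G \<le> card H * card K"
proof -
  define sg where "sg f = {(x, v) \<in> X \<times> V. v \<le> f x}" for f :: "'a \<Rightarrow> 'b"
  have "f = g" if "f \<in> X \<rightarrow>\<^sub>E V" "g \<in> X \<rightarrow>\<^sub>E V" "sg f = sg g" for f g
  proof (rule PiE_ext[OF that(1,2)])
    fix x assume "x \<in> X"
    then have "f x \<in> V" "g x \<in> V" using that(1,2) by auto
    then have "(x, f x) \<in> sg f" "(x, g x) \<in> sg g" using \<open>x \<in> X\<close> by (auto simp: sg_def)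
    then have "f x \<le> g x" "g x \<le> f x" using that(3) by (auto simp: sg_def)
    then show "f x = g x" by simp
  qed
  then have inj: "inj_on sg (X \<rightarrow>\<^sub>E V)" by (auto intro: inj_onI)
  have un: "sg f \<union> sg g = sg (\<lambda>x\<in>X. max (f x) (g x))"
    and int: "sg f \<inter> sg g = sg (\<lambda>x\<in>X. min (f x) (g x))" for f g
    by (auto simp: sg_def le_max_iff_disj)
  have "card (sg ` F) * card (sg ` G) \<le> card (sg ` H) * card (sg ` K)"
  proof (rule card_families_union_inter[of "X \<times> V"])
    show "finite (X \<times> V)" using assms(1,2) by simp
    show "A \<union> B \<in> sg ` H" "A \<inter> B \<in> sg ` K" if AB: "A \<in> sg ` F" "B \<in> sg ` G" for A B
    proof -
      obtain f g where "f \<in> F" "g \<in> G" "A = sg f" "B = sg g" using AB by blast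
      then show "A \<union> B \<in> sg ` H" "A \<inter> B \<in> sg ` K" using max min by (simp_all add: un int)
    qed
  qed (auto simp: sg_def)
  then show ?thesis
    using sub by (simp add: card_image inj_on_subset[OF inj])
qed

section \<open>Splittings of a fixed sum\<close>

text \<open>These are the decompositions \<open>\<mu> = T + (\<mu> - T)\<close> into two order preserving maps, recorded by the
  first summand. For \<open>c = 0\<close> both summands take values in \<open>{0..t}\<close>. The parameter \<open>c\<close> lets \<open>T\<close> drop
  to \<open>-c\<close> and, correspondingly, \<open>\<mu> - T\<close> rise to \<open>t + c\<close>; these are the ranges that
  \<open>T \<mapsto> \<mu> - c - T\<close> maps to themselves.\<close>

definition splittings ::
  "'a set \<Rightarrow> ('a \<Rightarrow> 'a \<Rightarrow> bool) \<Rightarrow> ('a \<Rightarrow> int) \<Rightarrow> int \<Rightarrow> int \<Rightarrow> 'a \<Rightarrow> int \<Rightarrow> ('a \<Rightarrow> int) set" where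
  "splittings X prec \<mu> t c z k = {T \<in> X \<rightarrow>\<^sub>E {-c..t}. T z = k
     \<and> (\<forall>x\<in>X. 0 \<le> \<mu> x - T x \<and> \<mu> x - T x \<le> t + c)
     \<and> (\<forall>x\<in>X. \<forall>y\<in>X. prec x y \<longrightarrow> T x \<le> T y \<and> \<mu> x - T x \<le> \<mu> y - T y)}"

lemma splittingsI:
  assumes "T \<in> extensional X" "T z = k"
    and "\<And>x. x \<in> X \<Longrightarrow> -c \<le> T x \<and> T x \<le> t \<and> 0 \<le> \<mu> x - T x \<and> \<mu> x - T x \<le> t + c"
    and "\<And>x y. x \<in> X \<Longrightarrow> y \<in> X \<Longrightarrow> prec x y \<Longrightarrow> T x \<le> T y \<and> \<mu> x - T x \<le> \<mu> y - T y"
  shows "T \<in> splittings X prec \<mu> t c z k"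
  using assms unfolding splittings_def PiE_iff atLeastAtMost_iff by blast

lemma splittings_bounds:
  assumes "T \<in> splittings X prec \<mu> t c z k" "x \<in> X"
  shows "-c \<le> T x \<and> T x \<le> t \<and> 0 \<le> \<mu> x - T x \<and> \<mu> x - T x \<le> t + c"
  using assms unfolding splittings_def PiE_iff atLeastAtMost_iff by blast

lemma splittings_mono:
  assumes "T \<in> splittings X prec \<mu> t c z k" "x \<in> X" "y \<in> X" "prec x y"
  shows "T x \<le> T y \<and> \<mu> x - T x \<le> \<mu> y - T y"
  using assms unfolding splittings_def by blast

lemma splittings_extensional_value:
  assumes "T \<in> splittings X prec \<mu> t c z k"
  shows "T \<in> extensional X" "T z = k"
  using assms unfolding splittings_def PiE_def by blast+

lemma splittings_reflect:
  assumes "z \<in> X" "T \<in> splittings X prec \<mu> t c z k"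
  shows "(\<lambda>x\<in>X. \<mu> x - c - T x) \<in> splittings X prec \<mu> t c z (\<mu> z - c - k)"
proof (rule splittingsI)
  fix x assume "x \<in> X"
  then show "-c \<le> (\<lambda>x\<in>X. \<mu> x - c - T x) x \<and> (\<lambda>x\<in>X. \<mu> x - c - T x) x \<le> t \<and>
      0 \<le> \<mu> x - (\<lambda>x\<in>X. \<mu> x - c - T x) x \<and> \<mu> x - (\<lambda>x\<in>X. \<mu> x - c - T x) x \<le> t + c"
    using splittings_bounds[OF assms(2), of x] by simp
next
  fix x y assume "x \<in> X" "y \<in> X" "prec x y"
  then show "(\<lambda>x\<in>X. \<mu> x - c - T x) x \<le> (\<lambda>x\<in>X. \<mu> x - c - T x) y \<and>
      \<mu> x - (\<lambda>x\<in>X. \<mu> x - c - T x) x \<le> \<mu> y - (\<lambda>x\<in>X. \<mu> x - c - T x) y"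
    using splittings_mono[OF assms(2), of x y] by simp
qed (use assms(1) splittings_extensional_value[OF assms(2)] in simp_all)

lemma card_splittings_reflect:
  assumes "z \<in> X"
  shows "card (splittings X prec \<mu> t c z (\<mu> z - c - k)) = card (splittings X prec \<mu> t c z k)"
proof -
  let ?r = "\<lambda>T. \<lambda>x\<in>X. \<mu> x - c - T x"
  have inv: "?r (?r T) = T" if "T \<in> splittings X prec \<mu> t c z k" for T k
    using that by (auto simp: splittings_def fun_eq_iff PiE_def extensional_def)
  have "bij_betw ?r (splittings X prec \<mu> t c z k) (splittings X prec \<mu> t c z (\<mu> z - c - k))"
  proof (rule bij_betw_byWitness[where f' = ?r])
    show "?r ` splittings X prec \<mu> t c z (\<mu> z - c - k) \<subseteq> splittings X prec \<mu> t c z k"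
      using splittings_reflect[OF assms, of _ prec \<mu> t c "\<mu> z - c - k"] by auto
  qed (use inv splittings_reflect[OF assms] in auto)
  then show ?thesis by (metis bij_betw_same_card)
qed

text \<open>The heart of the proof: exchange the values \<open>k\<close> and \<open>k + a\<close> between the exact and the
  relaxed splittings by \<open>max\<close> and \<open>min\<close>, and then cancel the relaxed counts, which agree by
  reflection.\<close>

lemma card_splittings_le:
  assumes "finite X" "z \<in> X" "0 \<le> a" "0 \<le> b" "\<mu> z = 2 * k + a + b"
  shows "card (splittings X prec \<mu> t 0 z k) \<le> card (splittings X prec \<mu> t 0 z (k + a))"
proof (cases "splittings X prec \<mu> t 0 z k = {}")
  case False
  let ?A = "splittings X prec \<mu> t 0 z" and ?B = "splittings X prec \<mu> t b z"
  have fin: "finite (splittings X prec \<mu> t c z j)" for c j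
    by (rule finite_subset[of _ "X \<rightarrow>\<^sub>E {-c..t}"])
      (auto simp: splittings_def \<open>finite X\<close> intro!: finite_PiE)
  have A_sub_B: "?A j \<subseteq> ?B j" for j
  proof
    fix T assume T: "T \<in> ?A j"
    show "T \<in> ?B j"
    proof (rule splittingsI[OF splittings_extensional_value[OF T] _ splittings_mono[OF T]])
      show "-b \<le> T x \<and> T x \<le> t \<and> 0 \<le> \<mu> x - T x \<and> \<mu> x - T x \<le> t + b" if "x \<in> X" for x
        using splittings_bounds[OF T that] \<open>0 \<le> b\<close> by simp
    qed
  qed
  have B_sub: "?B j \<subseteq> X \<rightarrow>\<^sub>E {-b..t}" for j
    by (auto simp: splittings_def)
  \<comment> \<open>Relaxing by exactly \<open>b\<close> makes the reflection swap the two values: \<open>\<mu> z - b - k = k + a\<close>.\<close>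
  have B_eq: "card (?B (k + a)) = card (?B k)"
    using card_splittings_reflect[OF \<open>z \<in> X\<close>, of prec \<mu> t b k] assms(5) by (simp add: algebra_simps)
  have pos: "0 < card (?B k)"
    using False A_sub_B fin by (metis card_gt_0_iff subset_empty)
  have "card (?A k) * card (?B (k + a)) \<le> card (?A (k + a)) * card (?B k)"
  proof (rule card_functions_max_min[of X "{-b..t}"])
    fix T E assume T: "T \<in> ?A k" and E: "E \<in> ?B (k + a)"
    note TE_z = splittings_extensional_value(2)[OF T] splittings_extensional_value(2)[OF E]
    have bounds: "0 \<le> T x" "T x \<le> t" "0 \<le> \<mu> x - T x" "\<mu> x - T x \<le> t"
        "-b \<le> E x" "E x \<le> t" "0 \<le> \<mu> x - E x" "\<mu> x - E x \<le> t + b" if "x \<in> X" for x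
      using splittings_bounds[OF T that] splittings_bounds[OF E that] by simp_all
    have mono: "T x \<le> T y" "\<mu> x - T x \<le> \<mu> y - T y" "E x \<le> E y" "\<mu> x - E x \<le> \<mu> y - E y"
      if "x \<in> X" "y \<in> X" "prec x y" for x y
      using splittings_mono[OF T that] splittings_mono[OF E that] by simp_all
    let ?M = "\<lambda>x\<in>X. max (T x) (E x)" and ?m = "\<lambda>x\<in>X. min (T x) (E x)"
    show "?M \<in> ?A (k + a)"
    proof (rule splittingsI)
      show "-0 \<le> ?M x \<and> ?M x \<le> t \<and> 0 \<le> \<mu> x - ?M x \<and> \<mu> x - ?M x \<le> t + 0" if "x \<in> X" for x
        using bounds[OF that] that by (simp add: max_def)
      show "?M x \<le> ?M y \<and> \<mu> x - ?M x \<le> \<mu> y - ?M y" if "x \<in> X" "y \<in> X" "prec x y" for x y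
        using mono[OF that] that by (simp add: max_def)
    qed (use TE_z \<open>z \<in> X\<close> \<open>0 \<le> a\<close> in simp_all)
    show "?m \<in> ?B k"
    proof (rule splittingsI)
      show "-b \<le> ?m x \<and> ?m x \<le> t \<and> 0 \<le> \<mu> x - ?m x \<and> \<mu> x - ?m x \<le> t + b" if "x \<in> X" for x
        using bounds[OF that] that \<open>0 \<le> b\<close> by (simp add: min_def)
      show "?m x \<le> ?m y \<and> \<mu> x - ?m x \<le> \<mu> y - ?m y" if "x \<in> X" "y \<in> X" "prec x y" for x y
        using mono[OF that] that by (simp add: min_def)
    qed (use TE_z \<open>z \<in> X\<close> \<open>0 \<le> a\<close> in simp_all)
  qed (use \<open>finite X\<close> A_sub_B B_sub in blast)+
  then show ?thesis
    using B_eq pos by simp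
qed simp

section \<open>Coefficients of products\<close>

definition weight_exp :: "nat \<Rightarrow> (nat \<Rightarrow> 'a) \<Rightarrow> ('a \<Rightarrow> nat) \<Rightarrow> nat \<Rightarrow>\<^sub>0 nat" where
  "weight_exp n x T = (\<Sum>i=1..n. Poly_Mapping.single i (T (x i)))"

lemma lookup_weight_exp:
  "Poly_Mapping.lookup (weight_exp n x T) i = (if i \<in> {1..n} then T (x i) else 0)"
  unfolding weight_exp_def lookup_sum lookup_single
  by (simp add: when_def)

lemma qvar_power: "qvar i ^ e = Poly_Mapping.single (Poly_Mapping.single i e) 1"
  by (induction e) (simp_all add: qvar_def mult_single single_add[symmetric])

lemma prod_qvar_power:
  "(\<Prod>i=1..n. qvar i ^ T (x i)) = Poly_Mapping.single (weight_exp n x T) 1"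
proof -
  have "(\<Prod>i\<in>I. Poly_Mapping.single (f i) (1::real)) = Poly_Mapping.single (sum f I) 1"
    if "finite I" for I and f :: "nat \<Rightarrow> nat \<Rightarrow>\<^sub>0 nat"
    using that by induction (simp_all add: mult_single)
  then show ?thesis
    by (simp add: qvar_power weight_exp_def)
qed

lemma finite_PP: "finite X \<Longrightarrow> finite (PP X prec t)"
  by (rule finite_subset[of _ "X \<rightarrow>\<^sub>E {0..t}"]) (auto simp: PP_def intro!: finite_PiE)

definition PP_pairs ::
  "'a set \<Rightarrow> ('a \<Rightarrow> 'a \<Rightarrow> bool) \<Rightarrow> nat \<Rightarrow> ('a \<Rightarrow> int) \<Rightarrow> 'a \<Rightarrow> int \<Rightarrow> int \<Rightarrow> (('a \<Rightarrow> nat) \<times> ('a \<Rightarrow> nat)) set" where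
  "PP_pairs X prec t \<mu> z k l = {(T, S) \<in> PP X prec t \<times> PP X prec t.
     int (T z) = k \<and> int (S z) = l \<and> (\<forall>y\<in>X. int (T y) + int (S y) = \<mu> y)}"

lemma lookup_Omega_q_mult:
  assumes "finite X"
  shows "Poly_Mapping.lookup (Omega_q X prec n x t z k * Omega_q X prec n x t z l) m =
    card {(T, S) \<in> PP X prec t \<times> PP X prec t.
      int (T z) = k \<and> int (S z) = l \<and> weight_exp n x T + weight_exp n x S = m}"
proof -
  define A where "A k = {T \<in> PP X prec t. int (T z) = k}" for k
  have fin: "finite (A k)" for k
    using finite_PP[OF assms] by (simp add: A_def)
  have "Omega_q X prec n x t z k * Omega_q X prec n x t z l =
      (\<Sum>(T, S)\<in>A k \<times> A l. Poly_Mapping.single (weight_exp n x T + weight_exp n x S) 1)"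
    unfolding Omega_q_def prod_qvar_power A_def sum_product mult_single sum.cartesian_product
    by simp
  then have "Poly_Mapping.lookup (Omega_q X prec n x t z k * Omega_q X prec n x t z l) m =
      (\<Sum>p\<in>A k \<times> A l. of_bool (weight_exp n x (fst p) + weight_exp n x (snd p) = m))"
    by (simp add: lookup_sum lookup_single when_def of_bool_def case_prod_beta)
  also have "\<dots> = card {p \<in> A k \<times> A l. weight_exp n x (fst p) + weight_exp n x (snd p) = m}"
    using fin by (simp add: Int_def)
  also have "{p \<in> A k \<times> A l. weight_exp n x (fst p) + weight_exp n x (snd p) = m} =
      {(T, S) \<in> PP X prec t \<times> PP X prec t.
        int (T z) = k \<and> int (S z) = l \<and> weight_exp n x T + weight_exp n x S = m}"
    by (auto simp: A_def)
  finally show ?thesis .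
qed

text \<open>The labels exhaust \<open>X\<close>, so the exponent of a product of two monomials determines the
  pointwise sum of the two maps and nothing more.\<close>

lemma weight_exp_add_eq_iff:
  assumes "x ` {1..n} = X"
  shows "weight_exp n x T + weight_exp n x S = weight_exp n x T' + weight_exp n x S'
    \<longleftrightarrow> (\<forall>y\<in>X. T y + S y = T' y + S' y)"
  unfolding assms[symmetric]
  by (auto simp: poly_mapping_eq_iff fun_eq_iff lookup_add lookup_weight_exp)

text \<open>With the sum fixed, the second map of a pair is redundant. The value of \<open>S\<close> at \<open>z\<close> comes out as
  \<open>l\<close> because \<open>\<mu> z = k + l\<close>.\<close>

lemma card_PP_pairs:
  assumes "z \<in> X" "\<mu> z = k + l"
  shows "card (PP_pairs X prec t \<mu> z k l) = card (splittings X prec \<mu> (int t) 0 z k)"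
proof -
  let ?f = "\<lambda>(T, S :: 'a \<Rightarrow> nat). \<lambda>y\<in>X. int (T y)"
  let ?g = "\<lambda>T. (\<lambda>y\<in>X. nat (T y), \<lambda>y\<in>X. nat (\<mu> y - T y))"
  have "bij_betw ?f (PP_pairs X prec t \<mu> z k l) (splittings X prec \<mu> (int t) 0 z k)"
  proof (rule bij_betw_byWitness[where f' = ?g])
    show "\<forall>p\<in>PP_pairs X prec t \<mu> z k l. ?g (?f p) = p"
    proof
      fix p assume p: "p \<in> PP_pairs X prec t \<mu> z k l"
      obtain T S where TS: "p = (T, S)" by fastforce
      have ext: "T \<in> extensional X" "S \<in> extensional X"
        and sum: "\<And>y. y \<in> X \<Longrightarrow> \<mu> y - int (T y) = int (S y)"
        using p by (auto simp: TS PP_pairs_def PP_def PiE_def simp flip: diff_eq_eq)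
      have "nat (int (T y)) = T y" "nat (\<mu> y - int (T y)) = S y" if "y \<in> X" for y
        using sum[OF that] by simp_all
      then show "?g (?f p) = p"
        using ext by (auto simp: TS fun_eq_iff extensional_def)
    qed
    show "\<forall>T\<in>splittings X prec \<mu> (int t) 0 z k. ?f (?g T) = T"
      by (auto simp: splittings_def fun_eq_iff PiE_iff extensional_def)
    show "?f ` PP_pairs X prec t \<mu> z k l \<subseteq> splittings X prec \<mu> (int t) 0 z k"
    proof clarify
      fix T S assume "(T, S) \<in> PP_pairs X prec t \<mu> z k l"
      then have "T \<in> PP X prec t" "S \<in> PP X prec t" "int (T z) = k"
        and sum: "\<forall>y\<in>X. \<mu> y - int (T y) = int (S y)"
        by (auto simp: PP_pairs_def simp flip: diff_eq_eq)
      then show "(\<lambda>y\<in>X. int (T y)) \<in> splittings X prec \<mu> (int t) 0 z k"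
        using \<open>z \<in> X\<close> by (auto simp: splittings_def PP_def PiE_iff)
    qed
    show "?g ` splittings X prec \<mu> (int t) 0 z k \<subseteq> PP_pairs X prec t \<mu> z k l"
    proof clarify
      fix T assume T: "T \<in> splittings X prec \<mu> (int t) 0 z k"
      have "0 \<le> T y" "nat (T y) \<le> t" "0 \<le> \<mu> y - T y" "nat (\<mu> y - T y) \<le> t" if "y \<in> X" for y
        using splittings_bounds[OF T that] by (simp_all add: nat_le_iff)
      then show "?g T \<in> PP_pairs X prec t \<mu> z k l"
        using assms splittings_bounds[OF T assms(1)] splittings_mono[OF T]
          splittings_extensional_value(2)[OF T]
        by (auto simp: PP_pairs_def PP_def nat_mono)
    qed
  qed
  then show ?thesis by (rule bij_betw_same_card)
qed

lemma Omega_q_mult_coeff_ge: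
  assumes "finite X" "x ` {1..n} = X" "z \<in> X" "0 \<le> a" "0 \<le> b"
  shows "Omega_q X prec n x t z (k + a) * Omega_q X prec n x t z (k + b) \<ge>\<^sub>q
    Omega_q X prec n x t z k * Omega_q X prec n x t z (k + a + b)"
  unfolding coeff_ge_def
proof
  fix m
  let ?P = "\<lambda>k l. {(T, S) \<in> PP X prec t \<times> PP X prec t.
      int (T z) = k \<and> int (S z) = l \<and> weight_exp n x T + weight_exp n x S = m}"
  have "card (?P k (k + a + b)) \<le> card (?P (k + a) (k + b))"
  proof (cases "?P k (k + a + b) = {}")
    case True
    then show ?thesis by (simp only: card.empty)
  next
    case False
    \<comment> \<open>Any one pair with exponent \<open>m\<close> supplies the common sum \<open>\<mu>\<close> of all of them.\<close>
    then obtain T\<^sub>0 S\<^sub>0 where z: "int (T\<^sub>0 z) = k" "int (S\<^sub>0 z) = k + a + b"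
      and m: "weight_exp n x T\<^sub>0 + weight_exp n x S\<^sub>0 = m"
      by auto
    define \<mu> where "\<mu> y = int (T\<^sub>0 y) + int (S\<^sub>0 y)" for y
    have "weight_exp n x T + weight_exp n x S = m \<longleftrightarrow> (\<forall>y\<in>X. int (T y) + int (S y) = \<mu> y)" for T S
      unfolding m[symmetric] weight_exp_add_eq_iff[OF assms(2)] \<mu>_def by (simp flip: of_nat_add)
    then have P: "?P i j = PP_pairs X prec t \<mu> z i j" for i j
      by (simp add: PP_pairs_def)
    have \<mu>z: "\<mu> z = 2 * k + a + b"
      using z by (simp add: \<mu>_def)
    show ?thesis
      unfolding P using assms card_splittings_le[of X z a b \<mu> k prec "int t"]
      by (simp add: card_PP_pairs \<mu>z)
  qed
  then show "0 \<le> Poly_Mapping.lookup (Omega_q X prec n x t z (k + a) * Omega_q X prec n x t z (k + b)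
      - Omega_q X prec n x t z k * Omega_q X prec n x t z (k + a + b)) m"
    by (simp add: lookup_minus lookup_Omega_q_mult[OF assms(1)])
qed

theorem theorem9p3:
  fixes X :: "'a set" and prec :: "'a \<Rightarrow> 'a \<Rightarrow> bool"
    and n :: nat and x :: "nat \<Rightarrow> 'a" and t :: nat and z :: 'a
  assumes "finite_poset X prec"
    and "natural_labeling X prec n x"
    and "z \<in> X"
  shows "(\<forall>k::int. 0 \<le> k \<and> k \<le> int t \<longrightarrow>
            (Omega_q X prec n x t z k)\<^sup>2 \<ge>\<^sub>q
              Omega_q X prec n x t z (k - 1) * Omega_q X prec n x t z (k + 1))
       \<and> (\<forall>(a::int) (b::int) (k::int). 1 \<le> a \<and> 1 \<le> b \<and> 0 \<le> k \<and> k \<le> int t \<longrightarrow>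
            Omega_q X prec n x t z (k + a) * Omega_q X prec n x t z (k + b) \<ge>\<^sub>q
              Omega_q X prec n x t z k * Omega_q X prec n x t z (k + a + b))"
proof -
  have X: "finite X" "x ` {1..n} = X"
    using assms(1,2) by (auto simp: finite_poset_def natural_labeling_def bij_betw_def)
  note ge = Omega_q_mult_coeff_ge[OF X assms(3)]
  have "(Omega_q X prec n x t z k)\<^sup>2 \<ge>\<^sub>q
      Omega_q X prec n x t z (k - 1) * Omega_q X prec n x t z (k + 1)" for k
    \<comment> \<open>\<open>k - 1\<close> may be negative here; \<open>ge\<close> covers all integers.\<close>
    using ge[of 1 1 prec t "k - 1"] by (simp add: power2_eq_square)
  then show ?thesis
    using ge by simp
qed

end
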